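(* Let $r\ge0$ be an integer, let $m_1,\ldots,m_r$ be positive integers, and put $m:=m_1+\cdots+m_r$. Let $\alpha,\beta,a,c,d,f_1,\ldots,f_r$ be complex numbers such that none of $\beta,c,f_1,\ldots,f_r$ is a non-positive integer. Assume $(c-a-m)_m\neq0$, $a\ne f_j$ for $1\le j\le r$, and that the polynomial $Q_m(t)$ (defined in the context from $a,c,(f_j),(m_j)$) has degree $m$; let $\xi_1,\ldots,\xi_m$ be its zeros counted with multiplicity (all nonzero, since $Q_m(0)=1$). Then, for all complex $x$ with $|x|<1$ and $\Re(x)<\frac12$, $$ F^{1:\,r+2;\,1}_{\,1:\,r+1;\,0}\left[\left.\begin{array}{c}\alpha:\ a,\ \beta-d,\ (f_r+m_r);\ d\\ \beta:\ c,\ (f_r);\ -\end{array}\right|x,\ x\right] =(1-x)^{-\alpha}\,{}_{m+3}F_{m+2}\left[\begin{array}{c}\alpha,\ \beta-d,\ c-a-m,\ \xi_1+1,\ldots,\xi_m+1\\ \beta,\ c,\ \xi_1,\ldots,\xi_m\end{array};\frac{x}{x-1}\right]. $$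
   Context: Notation. $(x)_k$ is the Pochhammer symbol: $(x)_0=1$, $(x)_k=x(x+1)\cdots(x+k-1)$ for $k\ge1$. A finite parameter sequence $a_1,\ldots,a_p$ is abbreviated $(a_p)$, and $((a_p))_k:=(a_1)_k\cdots(a_p)_k$; $(f_r+m_r)$ denotes $f_1+m_1,\ldots,f_r+m_r$. Empty products equal $1$, empty parameter lists are allowed, and a dash denotes an empty parameter list. The power $(1-x)^{-\alpha}$ is the principal branch. The generalized hypergeometric series is $${}_pF_q\left[\begin{array}{c}a_1,\ldots,a_p\\ b_1,\ldots,b_q\end{array};z\right]=\sum_{k\ge0}\frac{(a_1)_k\cdots(a_p)_k}{(b_1)_k\cdots(b_q)_k}\frac{z^k}{k!}.$$ The Kamp\'e de F\'eriet function of two variables is $$F^{p:\,r;\,s}_{\,q:\,t;\,u}\left[\left.\begin{array}{c}(\alpha_p):\,(a_r);\,(b_s)\\(\beta_q):\,(c_t);\,(d_u)\end{array}\right|x,\,y\right]=\sum_{k=0}^\infty\sum_{l=0}^\infty\frac{((\alpha_p))_{k+l}}{((\beta_q))_{k+l}}\,\frac{((a_r))_k((b_s))_l}{((c_t))_k((d_u))_l}\,\frac{x^ky^l}{k!\,l!}.$$ Thus the left-hand side of the claim is $$\sum_{k,l\ge0}\frac{(\alpha)_{k+l}}{(\beta)_{k+l}}\frac{(a)_k(\beta-d)_k((f_r+m_r))_k\,(d)_l}{(c)_k((f_r))_k}\frac{x^{k+l}}{k!\,l!}.$$ Coefficients $C_{k,r}$. Let $\Lambda=(f_1)_{m_1}\cdots(f_r)_{m_r}$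 and define $\sigma_0,\ldots,\sigma_m$ by the polynomial identity $(f_1+x)_{m_1}\cdots(f_r+x)_{m_r}=\sum_{j=0}^m\sigma_jx^j$. For $0\le k\le m$ set $C_{k,r}=\frac1\Lambda\sum_{j=k}^m\sigma_j\,\mathbf S_j^{(k)}$, where $\mathbf S_j^{(k)}$ is the Stirling number of the second kind. Polynomial $Q_m$. With $\lambda:=c-a-m$, $$Q_m(t)=\frac1{(\lambda)_m}\sum_{k=0}^m(a)_k\,C_{k,r}\,(t)_k\,(\lambda-t)_{m-k},$$ which satisfies $Q_m(0)=1$. Convention: in the series with parameters $\xi_j+1$ over $\xi_j$, each quotient $(\xi_j+1)_k/(\xi_j)_k$ is understood as $(\xi_j+k)/\xi_j$. *)

theory Defs
  imports "HOL-Analysis.Analysis" "HOL-Combinatorics.Stirling"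
begin

definition poch_list :: "complex list \<Rightarrow> nat \<Rightarrow> complex" where
  "poch_list as k = (\<Prod>a\<leftarrow>as. pochhammer a k)"

definition hypergeom_term :: "complex list \<Rightarrow> complex list \<Rightarrow> complex \<Rightarrow> nat \<Rightarrow> complex" where
  "hypergeom_term as bs z k = poch_list as k / poch_list bs k * (z ^ k / fact k)"

definition hypergeom :: "complex list \<Rightarrow> complex list \<Rightarrow> complex \<Rightarrow> complex" where
  "hypergeom as bs z = (\<Sum>k. hypergeom_term as bs z k)"

text \<open>
  The generalized hypergeometric series with numerator parameters \<open>as\<close>, \<open>\<xi> + 1\<close> and denominator
  parameters \<open>bs\<close>, \<open>\<xi>\<close>, where \<open>\<xi>\<close> runs through \<open>xs\<close>.  Each quotient of Pochhammer symbols
  \<open>(\<xi> + 1)\<^sub>k / (\<xi>)\<^sub>k\<close> is read as \<open>(\<xi> + k) / \<xi>\<close>, so that a \<open>\<xi>\<close> that is a negative integer is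
  admissible.  If no \<open>\<xi>\<close> is a non-positive integer, this is just \<open>hypergeom\<close>; see
  \<open>hypergeom_shifted_eq_hypergeom\<close> below.
\<close>

definition hypergeom_shifted_term ::
  "complex list \<Rightarrow> complex list \<Rightarrow> complex list \<Rightarrow> complex \<Rightarrow> nat \<Rightarrow> complex" where
  "hypergeom_shifted_term as bs xs z k =
     hypergeom_term as bs z k * (\<Prod>\<xi>\<leftarrow>xs. (\<xi> + of_nat k) / \<xi>)"

definition hypergeom_shifted ::
  "complex list \<Rightarrow> complex list \<Rightarrow> complex list \<Rightarrow> complex \<Rightarrow> complex" where
  "hypergeom_shifted as bs xs z = (\<Sum>k. hypergeom_shifted_term as bs xs z k)"

text \<open>
  The argument order of the Kampe de Feriet function follows the usual array notation: first the
  row \<open>(\<alpha>) : (a) ; (b)\<close>, then the row \<open>(\<beta>) : (c) ; (d)\<close>.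
  The double series is taken in the sense of unordered (equivalently, for complex terms, absolute)
  summation over all pairs of indices.
\<close>

definition kampe_de_feriet_term ::
  "complex list \<Rightarrow> complex list \<Rightarrow> complex list \<Rightarrow> complex list \<Rightarrow> complex list \<Rightarrow> complex list \<Rightarrow>
   complex \<Rightarrow> complex \<Rightarrow> nat \<times> nat \<Rightarrow> complex" where
  "kampe_de_feriet_term \<alpha>s as bs \<beta>s cs ds x y = (\<lambda>(k, l).
     poch_list \<alpha>s (k + l) / poch_list \<beta>s (k + l) *
     ((poch_list as k * poch_list bs l) / (poch_list cs k * poch_list ds l)) *
     (x ^ k * y ^ l / (fact k * fact l)))"

definition kampe_de_feriet ::
  "complex list \<Rightarrow> complex list \<Rightarrow> complex list \<Rightarrow> complex list \<Rightarrow> complex list \<Rightarrow> complex list \<Rightarrow>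
   complex \<Rightarrow> complex \<Rightarrow> complex" where
  "kampe_de_feriet \<alpha>s as bs \<beta>s cs ds x y =
     (\<Sum>\<^sub>\<infinity>kl\<in>UNIV. kampe_de_feriet_term \<alpha>s as bs \<beta>s cs ds x y kl)"

definition sigma_poly :: "complex list \<Rightarrow> nat list \<Rightarrow> complex poly" where
  "sigma_poly fs ms = (\<Prod>(f, m)\<leftarrow>zip fs ms. pochhammer [:f, 1:] m)"

definition C_coeff :: "complex list \<Rightarrow> nat list \<Rightarrow> nat \<Rightarrow> complex" where
  "C_coeff fs ms k =
     1 / (\<Prod>(f, m)\<leftarrow>zip fs ms. pochhammer f m) *
     (\<Sum>j = k..sum_list ms. coeff (sigma_poly fs ms) j * of_nat (Stirling j k))"

definition Q_poly :: "complex \<Rightarrow> complex \<Rightarrow> complex list \<Rightarrow> nat list \<Rightarrow> complex poly" where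
  "Q_poly a c fs ms =
     (let m = sum_list ms; l = c - a - of_nat m in
        smult (1 / pochhammer l m)
          (\<Sum>k = 0..m. smult (pochhammer a k * C_coeff fs ms k)
             (pochhammer [:0, 1:] k * pochhammer [:l, -1:] (m - k))))"


lemma poly_pochhammer: "poly (pochhammer p n) t = pochhammer (poly p t) n"
  for p :: "complex poly"
  by (simp add: pochhammer_prod poly_prod)

lemma poly_sigma_poly:
  "poly (sigma_poly fs ms) x = (\<Prod>(f, m)\<leftarrow>zip fs ms. pochhammer (f + x) m)"
proof -
  have "poly (prod_list ps) x = prod_list (map (\<lambda>p. poly p x) ps)" for ps :: "complex poly list"
    by (induction ps) auto
  thus ?thesis
    by (simp add: sigma_poly_def poly_pochhammer o_def case_prod_unfold)
qed

lemma poly_Q_poly: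
  assumes "m = sum_list ms" "l = c - a - of_nat m"
  shows "poly (Q_poly a c fs ms) t =
    1 / pochhammer l m *
      (\<Sum>k = 0..m. pochhammer a k * C_coeff fs ms k * pochhammer t k * pochhammer (l - t) (m - k))"
  unfolding Q_poly_def Let_def assms by (simp add: poly_sum poly_pochhammer mult_ac)

lemma poly_Q_poly_0:
  assumes "length fs = length ms" "\<forall>f\<in>set fs. f \<notin> \<int>\<^sub>\<le>\<^sub>0"
    and "pochhammer (c - a - of_nat (sum_list ms)) (sum_list ms) \<noteq> 0"
  shows "poly (Q_poly a c fs ms) 0 = 1"
proof -
  define m where "m = sum_list ms"
  define \<Lambda> where "\<Lambda> = (\<Prod>(f, m)\<leftarrow>zip fs ms. pochhammer f m)"
  have "pochhammer f n \<noteq> 0" if "f \<in> set fs" for f n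
    using assms(2) that by (auto simp: pochhammer_eq_0_iff)
  hence \<Lambda>: "\<Lambda> \<noteq> 0"
    by (auto simp: \<Lambda>_def prod_list_zero_iff dest: set_zip_leftD)
  have "(\<Sum>j = 0..m. coeff (sigma_poly fs ms) j * of_nat (Stirling j 0)) =
        (\<Sum>j\<in>{0}. coeff (sigma_poly fs ms) j * of_nat (Stirling j 0))"
    by (intro sum.mono_neutral_right) (auto simp: gr0_conv_Suc)
  also have "\<dots> = \<Lambda>"
    using poly_sigma_poly[of fs ms 0] by (simp add: \<Lambda>_def poly_0_coeff_0)
  finally have C: "C_coeff fs ms 0 = 1"
    using \<Lambda> by (simp add: C_coeff_def \<Lambda>_def m_def)
  have "poly (Q_poly a c fs ms) 0 = 1 / pochhammer (c - a - of_nat m) m *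
      (\<Sum>k\<in>{0}. pochhammer a k * C_coeff fs ms k * pochhammer 0 k *
         pochhammer (c - a - of_nat m - 0) (m - k))"
    unfolding poly_Q_poly[OF m_def refl]
    by (intro arg_cong2[where f = "(*)"] refl sum.mono_neutral_right) (auto simp: pochhammer_0_left)
  thus ?thesis
    using C assms(3) by (simp add: m_def)
qed

lemma hypergeom_shifted_eq_hypergeom:
  assumes "\<forall>\<xi>\<in>set xs. \<xi> \<notin> \<int>\<^sub>\<le>\<^sub>0"
  shows "hypergeom_shifted as bs xs z = hypergeom (as @ map (\<lambda>\<xi>. \<xi> + 1) xs) (bs @ xs) z"
proof -
  have *: "pochhammer (\<xi> + 1) k / pochhammer \<xi> k = (\<xi> + of_nat k) / \<xi>"
    if "\<xi> \<notin> \<int>\<^sub>\<le>\<^sub>0" for \<xi> :: complex and k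
  proof -
    have nz: "\<xi> \<noteq> 0" "pochhammer \<xi> k \<noteq> 0"
      using that by (auto simp: pochhammer_eq_0_iff)
    have "\<xi> * pochhammer (\<xi> + 1) k = pochhammer \<xi> k * (\<xi> + of_nat k)"
      using pochhammer_rec[of \<xi> k] pochhammer_rec'[of \<xi> k] by (simp add: mult_ac)
    thus ?thesis
      using nz by (simp add: field_simps)
  qed
  have "(\<Prod>\<xi>\<leftarrow>xs. (\<xi> + of_nat k) / \<xi>) = poch_list (map (\<lambda>\<xi>. \<xi> + 1) xs) k / poch_list xs k" for k
    using assms by (induction xs) (auto simp: poch_list_def simp flip: *)
  hence "hypergeom_shifted_term as bs xs z = hypergeom_term (as @ map (\<lambda>\<xi>. \<xi> + 1) xs) (bs @ xs) z"
    by (auto simp: fun_eq_iff hypergeom_shifted_term_def hypergeom_term_def poch_list_def mult_ac)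
  thus ?thesis
    by (simp add: hypergeom_shifted_def hypergeom_def)
qed

end

theory Submission
  imports Defs "HOL-Complex_Analysis.Complex_Analysis"
    "HOL-Computational_Algebra.Fundamental_Theorem_Algebra"
begin

text \<open>
  Write \<open>A\<^sub>k = (a)\<^sub>k ((f + m))\<^sub>k / ((c)\<^sub>k ((f))\<^sub>k)\<close> and \<open>B\<^sub>n = (\<lambda>)\<^sub>n Q\<^sub>m(-n) / (c)\<^sub>n\<close>.
  Since \<open>((f + m))\<^sub>k / ((f))\<^sub>k\<close> is a polynomial in \<open>k\<close>, expanding it in falling factorials
  and applying Chu--Vandermonde shows that \<open>A\<close> is the binomial transform of \<open>(-1)\<^sup>n B\<^sub>n\<close>.
  A second use of Vandermonde identifies the coefficients of \<open>x\<^sup>N\<close> on both sides, with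
  \<open>(1 - x)\<close> to the power \<open>-\<alpha> - n\<close> expanded by the binomial series.  That rearrangement converges
  absolutely only for \<open>|x| < 1/2\<close>; the identity theorem extends the result to the convex
  domain \<open>|x| < 1\<close>, \<open>Re x < 1/2\<close>, on which \<open>|x / (x - 1)| < 1\<close>.
\<close>

section \<open>Finite identities\<close>

lemma pochhammer_nonzero:
  fixes c :: "'a::field_char_0"
  assumes "c \<notin> \<int>\<^sub>\<le>\<^sub>0"
  shows "pochhammer c n \<noteq> 0"
  using assms by (auto simp: pochhammer_eq_0_iff)

lemma pochhammer_shift_nonzero:
  fixes c :: "'a::field_char_0"
  assumes "c \<notin> \<int>\<^sub>\<le>\<^sub>0"
  shows "pochhammer (c + of_nat j) n \<noteq> 0"
  using pochhammer_nonzero[OF assms, of "j + n"] by (auto simp: pochhammer_product')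

text \<open>The factors c+i, ..., c+p-1, read backwards and negated, are 1-c-p, ..., -c-i.\<close>

lemma pochhammer_reflect:
  fixes c :: "'a::comm_ring_1"
  assumes "i \<le> p"
  shows "pochhammer (c + of_nat i) (p - i) =
    (-1) ^ (p - i) * pochhammer (1 - c - of_nat p) (p - i)"
  using pochhammer_minus'[of "c + of_nat p - 1" "p - i"] assms
  by (simp add: of_nat_diff algebra_simps)

text \<open>Chu--Vandermonde in the form \<open>\<^sub>2F\<^sub>1(-p, c - a; c; 1) = (a)\<^sub>p / (c)\<^sub>p\<close>.\<close>

lemma pochhammer_ratio_binomial_sum:
  fixes a c :: "'a::field_char_0"
  assumes "c \<notin> \<int>\<^sub>\<le>\<^sub>0"
  shows "pochhammer a p / pochhammer c p =
    (\<Sum>i\<le>p. of_nat (p choose i) * (-1) ^ i * pochhammer (c - a) i / pochhammer c i)"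
proof -
  have "(\<Sum>i\<le>p. of_nat (p choose i) * (-1) ^ i * pochhammer (c - a) i / pochhammer c i) * pochhammer c p
      = (\<Sum>i\<le>p. (-1) ^ p * (of_nat (p choose i) * pochhammer (c - a) i *
           pochhammer (1 - c - of_nat p) (p - i)))"
    unfolding sum_distrib_right
  proof (rule sum.cong)
    fix i assume "i \<in> {..p}"
    hence i: "i \<le> p" by simp
    have "(-1::'a) ^ i * (-1) ^ (p - i) = (-1) ^ p"
      using i by (simp flip: power_add)
    hence sgn: "(-1::'a) ^ p = (-1) ^ i * (-1) ^ (p - i)" by simp
    show "of_nat (p choose i) * (-1) ^ i * pochhammer (c - a) i / pochhammer c i * pochhammer c p =
        (-1) ^ p * (of_nat (p choose i) * pochhammer (c - a) i *
           pochhammer (1 - c - of_nat p) (p - i))"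
      using pochhammer_nonzero[OF assms, of i] pochhammer_product[OF i, of c]
      by (simp add: pochhammer_reflect[OF i] sgn mult_ac)
  qed simp
  \<comment> \<open>Vandermonde for rising factorials: the bases c-a and 1-c-p add up to
    1-a-p.\<close>
  also have "\<dots> = (-1) ^ p * pochhammer (1 - a - of_nat p) p"
    unfolding sum_distrib_left[symmetric] pochhammer_binomial_sum[symmetric]
    by (simp add: algebra_simps)
  also have "\<dots> = pochhammer a p"
    using pochhammer_reflect[of 0 p a] by simp
  finally show ?thesis
    using pochhammer_nonzero[OF assms, of p] by (simp add: field_simps)
qed

section \<open>Falling factorials and the coefficients \<open>C_coeff\<close>\<close>

text \<open>The term \<open>(-1) ^ i * pochhammer (-x) i\<close> is the falling factorial
  x(x-1)...(x-i+1). The induction matches the rule x F_i = F_(i+1) + i F_i with the recurrence of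
  the Stirling numbers.\<close>

lemma power_eq_sum_Stirling:
  fixes x :: "'a::comm_ring_1"
  shows "x ^ j = (\<Sum>i\<le>j. of_nat (Stirling j i) * ((-1) ^ i * pochhammer (-x) i))"
proof (induction j)
  case (Suc j)
  define F where "F i = (-1) ^ i * pochhammer (-x) i" for i
  have step: "x * F i = F (Suc i) + of_nat i * F i" for i
    by (simp add: F_def pochhammer_Suc algebra_simps)
  have "x ^ Suc j = (\<Sum>i\<le>j. of_nat (Stirling j i) * (x * F i))"
    using Suc by (simp add: F_def sum_distrib_left mult_ac)
  also have "\<dots> = (\<Sum>i\<le>j. of_nat (Stirling j i) * F (Suc i)) +
      (\<Sum>i\<le>j. of_nat (i * Stirling j i) * F i)"
    by (simp add: step algebra_simps sum.distrib)
  \<comment> \<open>The range grows by one because \<open>Stirling j (Suc j)\<close> is zero; then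
    the vanishing term at 0 is dropped, so that both sums run over \<open>F (Suc i)\<close>.\<close>
  also have "(\<Sum>i\<le>j. of_nat (i * Stirling j i) * F i) = (\<Sum>i\<le>Suc j. of_nat (i * Stirling j i) * F i)"
    by simp
  also have "\<dots> = (\<Sum>i\<le>j. of_nat (Suc i * Stirling j (Suc i)) * F (Suc i))"
    by (subst sum.atMost_Suc_shift) simp
  also have "(\<Sum>i\<le>j. of_nat (Stirling j i) * F (Suc i)) + \<dots> =
      (\<Sum>i\<le>j. of_nat (Stirling (Suc j) (Suc i)) * F (Suc i))"
    by (simp add: algebra_simps sum.distrib)
  also have "\<dots> = (\<Sum>i\<le>Suc j. of_nat (Stirling (Suc j) i) * F i)"
    by (subst sum.atMost_Suc_shift) simp
  finally show ?case by (simp add: F_def)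
qed simp

text \<open>This bound ensures that the cut-off at \<open>sum_list ms\<close> in
  \<open>C_coeff\<close> loses no coefficient.\<close>

lemma degree_sigma_poly_le:
  assumes "length fs = length ms"
  shows "degree (sigma_poly fs ms) \<le> sum_list ms"
  using assms
proof (induction fs ms rule: list_induct2)
  case (Cons f fs m ms)
  have "degree (pochhammer [:f, 1:] m) \<le> m"
  proof (induction m)
    case (Suc m)
    have "degree ([:f, 1:] + of_nat m) \<le> 1"
      by (intro degree_add_le) auto
    thus ?case
      using Suc degree_mult_le[of "pochhammer [:f, 1:] m" "[:f, 1:] + of_nat m"]
      by (simp add: pochhammer_Suc)
  qed simp
  thus ?case
    using Cons degree_mult_le[of "pochhammer [:f, 1:] m" "sigma_poly fs ms"]
    by (simp add: sigma_poly_def)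
qed (simp add: sigma_poly_def)

text \<open>Splitting (f)_(m+k) in both orders gives (f)_m (f+m)_k = (f)_k (f+k)_m, so each quotient
  is a polynomial in k.\<close>

lemma poch_list_shift_ratio:
  assumes "length fs = length ms" "\<forall>f\<in>set fs. f \<notin> \<int>\<^sub>\<le>\<^sub>0"
  shows "poch_list (map2 (\<lambda>f m. f + of_nat m) fs ms) k / poch_list fs k =
    poly (sigma_poly fs ms) (of_nat k) / (\<Prod>(f, m)\<leftarrow>zip fs ms. pochhammer f m)"
  using assms
proof (induction fs ms rule: list_induct2)
  case (Cons f fs m ms)
  have "pochhammer f m * pochhammer (f + of_nat m) k = pochhammer f k * pochhammer (f + of_nat k) m"
    by (metis pochhammer_product' add.commute)
  moreover have "pochhammer f k \<noteq> 0" "pochhammer f m \<noteq> 0"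
    using Cons.prems by (auto intro!: pochhammer_nonzero)
  ultimately have "pochhammer (f + of_nat m) k / pochhammer f k =
      pochhammer (f + of_nat k) m / pochhammer f m"
    by (simp add: field_simps)
  moreover have "poch_list (map2 (\<lambda>f m. f + of_nat m) fs ms) k / poch_list fs k =
      poly (sigma_poly fs ms) (of_nat k) / (\<Prod>(f, m)\<leftarrow>zip fs ms. pochhammer f m)"
    using Cons by simp
  ultimately have "(pochhammer (f + of_nat m) k / pochhammer f k) *
        (poch_list (map2 (\<lambda>f m. f + of_nat m) fs ms) k / poch_list fs k) =
      (pochhammer (f + of_nat k) m / pochhammer f m) *
        (poly (sigma_poly fs ms) (of_nat k) / (\<Prod>(f, m)\<leftarrow>zip fs ms. pochhammer f m))"
    by (simp only:)
  thus ?case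
    by (simp add: poly_sigma_poly poch_list_def)
qed (simp add: poch_list_def sigma_poly_def)

text \<open>Every power of x is expanded by Stirling numbers and the triangle i \<le> j \<le> m is
  summed in the other order. So the \<open>C_coeff\<close> are coordinates in the basis of falling
  factorials.\<close>

lemma poly_sigma_poly_eq_sum_C_coeff:
  assumes "length fs = length ms"
  shows "poly (sigma_poly fs ms) x / (\<Prod>(f, m)\<leftarrow>zip fs ms. pochhammer f m) =
    (\<Sum>i\<le>sum_list ms. C_coeff fs ms i * ((-1) ^ i * pochhammer (-x) i))"
proof -
  define m where "m = sum_list ms"
  define s where "s = coeff (sigma_poly fs ms)"
  define F where "F i = (-1) ^ i * pochhammer (-x) i" for i
  have "poly (sigma_poly fs ms) x = (\<Sum>j\<le>m. s j * x ^ j)"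
    unfolding s_def m_def poly_altdef using degree_sigma_poly_le[OF assms]
    by (intro sum.mono_neutral_left) (auto simp: coeff_eq_0)
  also have "\<dots> = (\<Sum>j\<le>m. \<Sum>i\<le>j. s j * of_nat (Stirling j i) * F i)"
    by (subst power_eq_sum_Stirling) (simp add: F_def sum_distrib_left mult_ac)
  also have "\<dots> = (\<Sum>i\<le>m. \<Sum>j=i..m. s j * of_nat (Stirling j i) * F i)"
    unfolding sum.Sigma[OF finite_atMost ballI[OF finite_atMost]]
      sum.Sigma[OF finite_atMost ballI[OF finite_atLeastAtMost]]
    by (rule sum.reindex_bij_witness[of _ "\<lambda>(i,j). (j,i)" "\<lambda>(j,i). (i,j)"]) auto
  finally show ?thesis
    by (simp add: C_coeff_def F_def m_def s_def sum_divide_distrib sum_distrib_right sum_distrib_left)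
qed

text \<open>Both sides count the ways to mark \<open>j\<close> of \<open>k\<close> elements in order and extend the marked set to
  an \<open>n\<close>-element one.\<close>

lemma falling_factorial_choose:
  assumes "j \<le> n" "n \<le> k"
  shows "(-1) ^ j * pochhammer (-of_nat k) j * of_nat ((k - j) choose (n - j)) =
    of_nat (k choose n) * ((-1) ^ j * pochhammer (-of_nat n) j :: 'a::field_char_0)"
proof -
  have F: "(-1) ^ j * pochhammer (-of_nat N) j = (of_nat (N choose j) * fact j :: 'a)" for N
    by (simp add: binomial_gbinomial gbinomial_pochhammer)
  have "(k choose n) * (n choose j) = (k choose j) * ((k - j) choose (n - j))"
    using assms by (rule choose_mult)
  hence "of_nat (k choose n) * of_nat (n choose j) =
      (of_nat (k choose j) * of_nat ((k - j) choose (n - j)) :: 'a)"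
    by (simp flip: of_nat_mult)
  thus ?thesis by (simp add: F mult_ac)
qed


section \<open>Values of \<open>Q_poly\<close> at negative integers, and the binomial
  transform\<close>

text \<open>With \<lambda> = c-a-m, the product (\<lambda>)_n (\<lambda>+n)_(m-j) is
  (\<lambda>)_(m+n-j) = (\<lambda>)_m (c-a)_(n-j) for j \<le> n, and the common factor (\<lambda>)_m
  cancels the normalisation of \<open>Q_poly\<close>.\<close>

lemma Q_poly_at_minus_nat:
  assumes "pochhammer (c - a - of_nat (sum_list ms)) (sum_list ms) \<noteq> 0"
  shows "pochhammer (c - a - of_nat (sum_list ms)) n * poly (Q_poly a c fs ms) (-of_nat n) =
    (\<Sum>j\<le>sum_list ms. C_coeff fs ms j * (pochhammer a j * pochhammer (-of_nat n) j * pochhammer (c - a) (n - j)))"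
proof -
  define m where "m = sum_list ms"
  define l where "l = c - a - of_nat m"
  have "pochhammer l n * (pochhammer a j * C_coeff fs ms j * pochhammer (-of_nat n) j * pochhammer (l + of_nat n) (m - j)) =
     pochhammer l m * (C_coeff fs ms j * (pochhammer a j * pochhammer (-of_nat n) j * pochhammer (c - a) (n - j)))"
    if j: "j \<le> m" for j
  proof (cases "j \<le> n")
    case True
    have "n + (m - j) = m + (n - j)" using j True by simp
    hence "pochhammer l n * pochhammer (l + of_nat n) (m - j) =
        pochhammer l m * pochhammer (l + of_nat m) (n - j)"
      by (metis pochhammer_product')
    thus ?thesis by (simp add: l_def mult_ac)
  next
    case False
    \<comment> \<open>Here \<open>n - j\<close> is truncated to 0, but (-n)_j contains the factor 0,
      so both sides vanish.\<close>
    thus ?thesis by (simp add: pochhammer_of_nat_eq_0_lemma)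
  qed
  hence "pochhammer l n * (\<Sum>j\<le>m. pochhammer a j * C_coeff fs ms j * pochhammer (-of_nat n) j * pochhammer (l + of_nat n) (m - j)) =
     pochhammer l m * (\<Sum>j\<le>m. C_coeff fs ms j * (pochhammer a j * pochhammer (-of_nat n) j * pochhammer (c - a) (n - j)))"
    unfolding sum_distrib_left by (intro sum.cong) auto
  moreover have "pochhammer l m \<noteq> 0" using assms by (simp add: l_def m_def)
  ultimately show ?thesis
    unfolding poly_Q_poly[OF m_def l_def] m_def[symmetric] l_def[symmetric]
    by (simp add: field_simps atLeast0AtMost)
qed

text \<open>Both Pochhammer symbols are split after j factors, and Chu--Vandermonde is applied to
  a+j and c+j, whose difference is still c-a. Putting n = i+j,
  \<open>falling_factorial_choose\<close> moves the falling factorial from k to n.\<close>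

lemma pochhammer_ratio_falling_factorial:
  fixes a c :: "'a::field_char_0"
  assumes c: "c \<notin> \<int>\<^sub>\<le>\<^sub>0"
  shows "pochhammer a k / pochhammer c k * ((-1) ^ j * pochhammer (-of_nat k) j) =
    (\<Sum>n\<le>k. of_nat (k choose n) * (-1) ^ n / pochhammer c n *
       (pochhammer a j * pochhammer (-of_nat n) j * pochhammer (c - a) (n - j)))"
proof (cases "j \<le> k")
  case True
  let ?G = "\<lambda>n. of_nat (k choose n) * (-1) ^ n / pochhammer c n *
       (pochhammer a j * pochhammer (-of_nat n) j * pochhammer (c - a) (n - j))"
  have "c + of_nat j \<notin> \<int>\<^sub>\<le>\<^sub>0"
  proof
    assume "c + of_nat j \<in> \<int>\<^sub>\<le>\<^sub>0"
    then obtain i where "c + of_nat j = - of_nat i" by (elim nonpos_Ints_cases')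
    hence "c = - of_nat (i + j)" by (simp add: algebra_simps eq_neg_iff_add_eq_0)
    with c show False by blast
  qed
  hence "pochhammer (a + of_nat j) (k - j) / pochhammer (c + of_nat j) (k - j) =
      (\<Sum>i\<le>k-j. of_nat ((k - j) choose i) * (-1) ^ i * pochhammer (c - a) i / pochhammer (c + of_nat j) i)"
    by (subst pochhammer_ratio_binomial_sum) simp_all
  moreover have "pochhammer a k / pochhammer c k * ((-1) ^ j * pochhammer (-of_nat k) j) =
      pochhammer a j / pochhammer c j * ((-1) ^ j * pochhammer (-of_nat k) j) *
        (pochhammer (a + of_nat j) (k - j) / pochhammer (c + of_nat j) (k - j))"
    by (simp add: pochhammer_product[OF True, of a] pochhammer_product[OF True, of c] mult_ac)
  ultimately have "pochhammer a k / pochhammer c k * ((-1) ^ j * pochhammer (-of_nat k) j) =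
     (\<Sum>i\<le>k-j. pochhammer a j / pochhammer c j * ((-1) ^ j * pochhammer (-of_nat k) j) *
       (of_nat ((k - j) choose i) * (-1) ^ i * pochhammer (c - a) i / pochhammer (c + of_nat j) i))"
    unfolding sum_distrib_left[symmetric] by (simp only:)
  also have "\<dots> = (\<Sum>i\<le>k-j. ?G (i + j))"
  proof (rule sum.cong)
    fix i assume "i \<in> {..k-j}"
    hence i: "i + j \<le> k" using True by auto
    have "(-1) ^ j * pochhammer (-of_nat k) j * of_nat ((k - j) choose i) =
       of_nat (k choose (i + j)) * ((-1) ^ j * pochhammer (-of_nat (i + j)) j :: 'a)"
      using falling_factorial_choose[of j "i + j" k, where ?'a = 'a] i by simp
    moreover have "pochhammer c (i + j) = pochhammer c j * pochhammer (c + of_nat j) i"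
      using pochhammer_product'[of c j i] by (simp add: add.commute)
    ultimately show "pochhammer a j / pochhammer c j * ((-1) ^ j * pochhammer (-of_nat k) j) *
       (of_nat ((k - j) choose i) * (-1) ^ i * pochhammer (c - a) i / pochhammer (c + of_nat j) i) = ?G (i + j)"
      by (simp add: power_add mult_ac)
  qed simp
  also have "\<dots> = (\<Sum>n\<in>{j..k}. ?G n)"
    by (rule sum.reindex_bij_witness[of _ "\<lambda>n. n - j" "\<lambda>i. i + j"]) (use True in auto)
  \<comment> \<open>For n < j the factor (-n)_j is zero.\<close>
  also have "\<dots> = (\<Sum>n\<le>k. ?G n)"
    by (rule sum.mono_neutral_left) (auto simp: pochhammer_of_nat_eq_0_lemma)
  finally show ?thesis .
next
  case False
  thus ?thesis by (simp add: pochhammer_of_nat_eq_0_lemma sum.neutral)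
qed

text \<open>The coefficient form of the Kummer-type transformation
  \<open>F(a, f + m; c, f; x) = e\<^sup>x F(c - a - m, \<xi> + 1; c, \<xi>; -x)\<close> of Miller and Paris.\<close>

lemma Kummer_type_coefficients:
  assumes "length fs = length ms" "\<forall>f\<in>set fs. f \<notin> \<int>\<^sub>\<le>\<^sub>0" "c \<notin> \<int>\<^sub>\<le>\<^sub>0"
    and "pochhammer (c - a - of_nat (sum_list ms)) (sum_list ms) \<noteq> 0"
  shows "pochhammer a k / pochhammer c k *
      (poch_list (map2 (\<lambda>f m. f + of_nat m) fs ms) k / poch_list fs k) =
    (\<Sum>n\<le>k. of_nat (k choose n) * (-1) ^ n *
      (pochhammer (c - a - of_nat (sum_list ms)) n / pochhammer c n *
       poly (Q_poly a c fs ms) (-of_nat n)))"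
proof -
  let ?G = "\<lambda>n j. pochhammer a j * pochhammer (-of_nat n) j * pochhammer (c - a) (n - j)"
  have "pochhammer a k / pochhammer c k *
      (poch_list (map2 (\<lambda>f m. f + of_nat m) fs ms) k / poch_list fs k) =
    (\<Sum>j\<le>sum_list ms. C_coeff fs ms j *
       (pochhammer a k / pochhammer c k * ((-1) ^ j * pochhammer (-of_nat k) j)))"
    by (simp only: poch_list_shift_ratio[OF assms(1,2)] poly_sigma_poly_eq_sum_C_coeff[OF assms(1)]
        sum_distrib_left mult_ac)
  also have "\<dots> = (\<Sum>j\<le>sum_list ms. \<Sum>n\<le>k. of_nat (k choose n) * (-1) ^ n / pochhammer c n *
       (C_coeff fs ms j * ?G n j))"
    by (unfold pochhammer_ratio_falling_factorial[OF assms(3)] sum_distrib_left) (simp only: mult_ac)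
  also have "\<dots> = (\<Sum>n\<le>k. of_nat (k choose n) * (-1) ^ n / pochhammer c n *
       (\<Sum>j\<le>sum_list ms. C_coeff fs ms j * ?G n j))"
    unfolding sum_distrib_left by (rule sum.swap)
  finally show ?thesis
    unfolding Q_poly_at_minus_nat[OF assms(4), symmetric] by (simp add: mult_ac)
qed

text \<open>After exchanging the sums, the trinomial revision of the binomial coefficients and (e)_k
  = (e)_n (e+n)_(k-n) leave a Vandermonde sum over k-n.\<close>

lemma binomial_transform_Vandermonde:
  fixes A B :: "nat \<Rightarrow> 'a::comm_ring_1"
  assumes "\<And>k. A k = (\<Sum>n\<le>k. of_nat (k choose n) * B n)"
  shows "(\<Sum>k\<le>N. of_nat (N choose k) * A k * pochhammer e k * pochhammer d (N - k)) =
    (\<Sum>n\<le>N. of_nat (N choose n) * B n * pochhammer e n * pochhammer (e + d + of_nat n) (N - n))"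
proof -
  let ?f = "\<lambda>k n. of_nat (N choose k) * (of_nat (k choose n) * B n) * pochhammer e k * pochhammer d (N - k)"
  have "(\<Sum>k\<le>N. of_nat (N choose k) * A k * pochhammer e k * pochhammer d (N - k)) =
      (\<Sum>k\<le>N. \<Sum>n\<le>k. ?f k n)"
    by (simp add: assms sum_distrib_left sum_distrib_right)
  also have "\<dots> = (\<Sum>n\<le>N. \<Sum>k=n..N. ?f k n)"
    unfolding sum.Sigma[OF finite_atMost ballI[OF finite_atMost]]
      sum.Sigma[OF finite_atMost ballI[OF finite_atLeastAtMost]]
    by (rule sum.reindex_bij_witness[of _ "\<lambda>(i,j). (j,i)" "\<lambda>(j,i). (i,j)"]) auto
  also have "\<dots> = (\<Sum>n\<le>N. of_nat (N choose n) * B n * pochhammer e n * pochhammer (e + d + of_nat n) (N - n))"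
  proof (rule sum.cong)
    fix n assume "n \<in> {..N}"
    hence n: "n \<le> N" by simp
    have "(\<Sum>k=n..N. ?f k n) = (\<Sum>i\<le>N-n. ?f (i + n) n)"
      by (rule sum.reindex_bij_witness[of _ "\<lambda>i. i + n" "\<lambda>k. k - n"]) (use n in auto)
    also have "\<dots> = (\<Sum>i\<le>N-n. of_nat (N choose n) * B n * pochhammer e n *
        (of_nat ((N - n) choose i) * pochhammer (e + of_nat n) i * pochhammer d (N - n - i)))"
    proof (rule sum.cong)
      fix i assume "i \<in> {..N-n}"
      hence i: "i + n \<le> N" using n by auto
      have "(N choose (i + n)) * ((i + n) choose n) = (N choose n) * ((N - n) choose i)"
        using choose_mult[of n "i + n" N] i by simp
      hence "of_nat (N choose (i + n)) * of_nat ((i + n) choose n) =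
          (of_nat (N choose n) * of_nat ((N - n) choose i) :: 'a)"
        by (simp flip: of_nat_mult)
      hence "of_nat (N choose (i + n)) * (of_nat ((i + n) choose n) * B n) =
          (of_nat (N choose n) * of_nat ((N - n) choose i) * B n :: 'a)"
        by (simp add: mult.assoc[symmetric])
      moreover have "pochhammer e (i + n) = pochhammer e n * pochhammer (e + of_nat n) i"
        using pochhammer_product'[of e n i] by (simp add: add.commute)
      moreover have "N - (i + n) = N - n - i" by simp
      ultimately show "?f (i + n) n = of_nat (N choose n) * B n * pochhammer e n *
        (of_nat ((N - n) choose i) * pochhammer (e + of_nat n) i * pochhammer d (N - n - i))"
        by (simp add: mult_ac)
    qed simp
    also have "\<dots> = of_nat (N choose n) * B n * pochhammer e n * pochhammer (e + of_nat n + d) (N - n)"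
      by (simp only: pochhammer_binomial_sum sum_distrib_left)
    finally show "(\<Sum>k=n..N. ?f k n) =
        of_nat (N choose n) * B n * pochhammer e n * pochhammer (e + d + of_nat n) (N - n)"
      by (simp add: algebra_simps)
  qed simp
  finally show ?thesis .
qed

section \<open>Sequences of subexponential growth\<close>

text \<open>Growth below every exponential rate, so that power series with such coefficients
  converge on the whole unit disc. Stated through bounds, the class is closed under sums and
  products without tracking growth exponents.\<close>

definition subexponential :: "(nat \<Rightarrow> complex) \<Rightarrow> bool" where
  "subexponential f \<longleftrightarrow> (\<forall>q. 0 \<le> q \<longrightarrow> q < 1 \<longrightarrow> (\<exists>M\<ge>0. \<forall>n. norm (f n) * q ^ n \<le> M))"

lemma subexponentialD:
  assumes "subexponential f" "0 \<le> q" "q < 1"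
  obtains M where "M \<ge> 0" "\<And>n. norm (f n) * q ^ n \<le> M"
  using assms by (auto simp: subexponential_def)

lemma subexponential_const: "subexponential (\<lambda>_. z)"
  unfolding subexponential_def
proof (intro allI impI)
  fix q :: real assume "0 \<le> q" "q < 1"
  thus "\<exists>M\<ge>0. \<forall>n::nat. norm z * q ^ n \<le> M"
    by (intro exI[of _ "norm z"]) (auto intro!: mult_left_le power_le_one)
qed

lemma subexponential_add:
  assumes "subexponential f" "subexponential g"
  shows "subexponential (\<lambda>n. f n + g n)"
  unfolding subexponential_def
proof (intro allI impI)
  fix q :: real assume q: "0 \<le> q" "q < 1"
  obtain M1 where M1: "M1 \<ge> 0" "\<And>n. norm (f n) * q ^ n \<le> M1" using subexponentialD[OF assms(1) q] by blast
  obtain M2 where M2: "M2 \<ge> 0" "\<And>n. norm (g n) * q ^ n \<le> M2" using subexponentialD[OF assms(2) q] by blast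
  have "norm (f n + g n) * q ^ n \<le> M1 + M2" for n
  proof -
    have "norm (f n + g n) * q ^ n \<le> (norm (f n) + norm (g n)) * q ^ n"
      using q by (intro mult_right_mono norm_triangle_ineq) auto
    thus ?thesis using M1(2)[of n] M2(2)[of n] by (simp add: algebra_simps)
  qed
  thus "\<exists>M\<ge>0. \<forall>n. norm (f n + g n) * q ^ n \<le> M"
    using M1 M2 by (intro exI[of _ "M1 + M2"]) auto
qed

lemma subexponential_mult:
  assumes "subexponential f" "subexponential g"
  shows "subexponential (\<lambda>n. f n * g n)"
  unfolding subexponential_def
proof (intro allI impI)
  fix q :: real assume q: "0 \<le> q" "q < 1"
  \<comment> \<open>Each of the two sequences receives half of the decay: q = s^2.\<close>
  define s where "s = sqrt q"
  have s: "0 \<le> s" "s < 1" and qs: "q = s * s" using q by (auto simp: s_def real_sqrt_lt_1_iff)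
  obtain M1 where M1: "M1 \<ge> 0" "\<And>n. norm (f n) * s ^ n \<le> M1" using subexponentialD[OF assms(1) s] by blast
  obtain M2 where M2: "M2 \<ge> 0" "\<And>n. norm (g n) * s ^ n \<le> M2" using subexponentialD[OF assms(2) s] by blast
  have "norm (f n * g n) * q ^ n \<le> M1 * M2" for n
  proof -
    have "norm (f n * g n) * q ^ n = (norm (f n) * s ^ n) * (norm (g n) * s ^ n)"
      by (simp add: qs norm_mult power_mult_distrib mult_ac)
    also have "\<dots> \<le> M1 * M2" using M1 M2 s by (intro mult_mono) auto
    finally show ?thesis .
  qed
  thus "\<exists>M\<ge>0. \<forall>n. norm (f n * g n) * q ^ n \<le> M"
    using M1 M2 by (intro exI[of _ "M1 * M2"]) auto
qed

text \<open>Consecutive quotients (a+n)/(c+n) tend to 1, so after multiplication by q < 1 the ratio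
  test applies with any s between q and 1; the terms of a convergent series are bounded.\<close>

lemma subexponential_pochhammer_ratio:
  assumes c: "c \<notin> \<int>\<^sub>\<le>\<^sub>0"
  shows "subexponential (\<lambda>n. pochhammer a n / pochhammer c n)"
  unfolding subexponential_def
proof (intro allI impI)
  fix q :: real assume q: "0 \<le> q" "q < 1"
  obtain s where s: "q < s" "s < 1" using q dense by blast
  let ?f = "\<lambda>n. norm (pochhammer a n / pochhammer c n) * q ^ n"
  have "((\<lambda>n. norm ((a + of_nat n) / (c + of_nat n)) * q) \<longlongrightarrow> 1 * q) sequentially"
  proof (intro tendsto_mult tendsto_const)
    have "((\<lambda>n. 1 + (a - c) / (c + of_nat n)) \<longlongrightarrow> 1 + 0) sequentially"
      by (intro tendsto_add tendsto_const tendsto_divide_0[OF tendsto_const]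
          tendsto_add_filterlim_at_infinity[OF tendsto_const] tendsto_of_nat)
    moreover have "1 + (a - c) / (c + of_nat n) = (a + of_nat n) / (c + of_nat n)" for n
    proof -
      have "c + of_nat n \<noteq> 0" using pochhammer_nonzero[OF c, of "Suc n"] by (simp add: pochhammer_Suc)
      thus ?thesis by (simp add: field_simps)
    qed
    ultimately show "((\<lambda>n. norm ((a + of_nat n) / (c + of_nat n))) \<longlongrightarrow> 1) sequentially"
      using tendsto_norm[of "\<lambda>n. (a + of_nat n) / (c + of_nat n)" 1 sequentially] by simp
  qed
  hence "eventually (\<lambda>n. norm ((a + of_nat n) / (c + of_nat n)) * q < s) sequentially"
    using s(1) by (intro order_tendstoD) auto
  then obtain N where N: "\<And>n. n \<ge> N \<Longrightarrow> norm ((a + of_nat n) / (c + of_nat n)) * q < s"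
    by (auto simp: eventually_sequentially)
  have "summable ?f"
  proof (rule summable_ratio_test[OF s(2)])
    fix n assume "n \<ge> N"
    have "?f (Suc n) = (norm ((a + of_nat n) / (c + of_nat n)) * q) * ?f n"
      by (simp add: pochhammer_Suc norm_mult norm_divide mult_ac)
    also have "\<dots> \<le> s * ?f n"
      using N[OF \<open>n \<ge> N\<close>] q by (intro mult_right_mono) auto
    finally show "norm (?f (Suc n)) \<le> s * norm (?f n)" using q by (simp add: abs_mult)
  qed
  hence "Bseq ?f" by (intro convergent_imp_Bseq convergentI[OF summable_LIMSEQ_zero])
  then obtain K where "K > 0" "\<And>n. norm (?f n) \<le> K" by (elim BseqE) auto
  thus "\<exists>M\<ge>0. \<forall>n. ?f n \<le> M" by (intro exI[of _ K]) (auto intro: order_trans[OF abs_ge_self] less_imp_le)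
qed

lemma subexponential_pochhammer_fact:
  "subexponential (\<lambda>n. pochhammer a n / fact n)"
  using subexponential_pochhammer_ratio[of 1 a] by (simp add: pochhammer_fact)

lemma subexponential_poly_of_nat: "subexponential (\<lambda>n. poly p (of_nat n))"
proof (induction p)
  case (pCons z p)
  \<comment> \<open>The sequence n itself is (2)_n / n! - 1, because (2)_n = (n+1)!.\<close>
  have "subexponential (\<lambda>n. pochhammer 2 n / fact n + (-1))"
    by (intro subexponential_add subexponential_const subexponential_pochhammer_fact)
  moreover have "pochhammer (2::complex) n = (of_nat n + 1) * fact n" for n
    using pochhammer_rec[of "1::complex" n] by (simp add: add.commute flip: pochhammer_fact)
  ultimately have "subexponential of_nat" by simp
  with pCons show ?case
    by (simp add: subexponential_add subexponential_mult subexponential_const)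
qed (simp add: subexponential_const)

section \<open>Convergence of single and double series\<close>

lemma subexponential_summable:
  assumes "subexponential f" "norm z < 1"
  shows "summable (\<lambda>n. f n * z ^ n)"
proof -
  \<comment> \<open>One factor s^n tames the coefficient, the other is a geometric majorant.\<close>
  define s where "s = sqrt (norm z)"
  have s: "0 \<le> s" "s < 1" and zs: "norm z = s * s" using assms(2) by (auto simp: s_def real_sqrt_lt_1_iff)
  obtain M where M: "M \<ge> 0" "\<And>n. norm (f n) * s ^ n \<le> M" using subexponentialD[OF assms(1) s] by blast
  show ?thesis
  proof (rule summable_comparison_test')
    show "summable (\<lambda>n. M * s ^ n)" using s by (intro summable_mult summable_geometric) auto
    show "norm (f n * z ^ n) \<le> M * s ^ n" for n
      using mult_right_mono[OF M(2)[of n], of "s ^ n"] s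
      by (simp add: norm_mult norm_power zs power_mult_distrib mult_ac)
  qed
qed

lemma subexponential_double_summable:
  assumes "subexponential u" "subexponential v" "subexponential w" "norm y < 1"
  shows "(\<lambda>(k, l). u (k + l) * v k * w l * y ^ (k + l)) summable_on UNIV"
proof -
  \<comment> \<open>The decay |y|^(k+l) is shared out in three: one part for \<open>u\<close>, one
    for \<open>v\<close> and \<open>w\<close> together, one for the geometric majorant.\<close>
  define s where "s = root 3 (norm y)"
  have s: "0 \<le> s" "s < 1" and ys: "norm y = s * s * s"
    using assms(4) real_root_pow_pos2[of 3 "norm y"]
    by (auto simp: s_def numeral_3_eq_3)
  obtain M1 where M1: "M1 \<ge> 0" "\<And>n. norm (u n) * s ^ n \<le> M1" using subexponentialD[OF assms(1) s] by blast
  obtain M2 where M2: "M2 \<ge> 0" "\<And>n. norm (v n) * s ^ n \<le> M2" using subexponentialD[OF assms(2) s] by blast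
  obtain M3 where M3: "M3 \<ge> 0" "\<And>n. norm (w n) * s ^ n \<le> M3" using subexponentialD[OF assms(3) s] by blast
  have geo: "((\<lambda>n. s ^ n) has_sum (1 / (1 - s))) UNIV"
    using s by (intro sums_nonneg_imp_has_sum geometric_sums) auto
  have "(\<lambda>(k, l). s ^ k * s ^ l) summable_on Sigma UNIV (\<lambda>_. UNIV)"
  proof (rule summable_on_SigmaI)
    show "((\<lambda>l. case (k, l) of (k, l) \<Rightarrow> s ^ k * s ^ l) has_sum (s ^ k * (1 / (1 - s)))) UNIV" for k :: nat
      using has_sum_cmult_right[OF geo, of "s ^ k"] by simp
    show "(\<lambda>k. s ^ k * (1 / (1 - s))) summable_on UNIV"
      using has_sum_cmult_left[OF geo] by (rule has_sum_imp_summable)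
  qed (use s in auto)
  hence "(\<lambda>kl. M1 * M2 * M3 * (case kl of (k, l) \<Rightarrow> s ^ k * s ^ l)) summable_on UNIV"
    by (intro summable_on_cmult_right) simp
  hence "(\<lambda>kl. norm (M1 * M2 * M3 * (case kl of (k, l) \<Rightarrow> s ^ k * s ^ l))) summable_on UNIV"
    using M1 M2 M3 s by (simp add: case_prod_unfold abs_mult)
  hence "(\<lambda>kl. norm (case kl of (k, l) \<Rightarrow> u (k + l) * v k * w l * y ^ (k + l))) summable_on UNIV"
  proof (rule Infinite_Sum.abs_summable_on_comparison_test)
    fix kl :: "nat \<times> nat"
    obtain k l where kl: "kl = (k, l)" by force
    have "norm (u (k + l) * v k * w l * y ^ (k + l)) =
        (norm (u (k + l)) * s ^ (k + l)) * (norm (v k) * s ^ k) * (norm (w l) * s ^ l) * (s ^ k * s ^ l)"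
      by (simp add: norm_mult norm_power ys power_mult_distrib power_add mult_ac)
    also have "\<dots> \<le> M1 * M2 * M3 * (s ^ k * s ^ l)"
      using M1 M2 M3 s by (intro mult_right_mono mult_mono) auto
    finally show "norm (case kl of (k, l) \<Rightarrow> u (k + l) * v k * w l * y ^ (k + l)) \<le>
        norm (M1 * M2 * M3 * (case kl of (k, l) \<Rightarrow> s ^ k * s ^ l))"
      using M1 M2 M3 s by (simp add: kl abs_mult)
  qed
  thus ?thesis by (rule abs_summable_summable)
qed

text \<open>An unordered sum may be grouped along antidiagonals, by reindexing (k, l) as (k+l, k).
  This turns a double series in powers y^(k+l) into a power series.\<close>

lemma has_sum_diagonal_sums:
  fixes f :: "nat \<times> nat \<Rightarrow> 'a::{topological_comm_monoid_add,t3_space}"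
  assumes "(f has_sum S) UNIV"
  shows "(\<lambda>N. \<Sum>k\<le>N. f (k, N - k)) sums S"
proof -
  have "((\<lambda>(N, k). f (k, N - k)) has_sum S) (Sigma UNIV (\<lambda>N. {..N}))"
    using assms
    by (subst has_sum_reindex_bij_witness[where i = "\<lambda>(k, l). (k + l, k)" and j = "\<lambda>(N, k). (k, N - k)"
          and T = UNIV and h = f]) auto
  hence "((\<lambda>N. \<Sum>k\<le>N. f (k, N - k)) has_sum S) UNIV"
    by (rule has_sum_SigmaD) (auto intro: has_sum_finite)
  thus ?thesis by (rule has_sum_imp_sums)
qed

section \<open>The transformation\<close>

text \<open>Only the binomial transform and the growth of \<open>A\<close> and \<open>B\<close>
  enter here, which separates the analysis from the parameters a, c and f.\<close>

theorem binomial_transform_double_series: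
  fixes A B :: "nat \<Rightarrow> complex" and \<alpha> \<beta> d x :: complex
  defines "L \<equiv> \<lambda>x (k, l). pochhammer \<alpha> (k + l) / pochhammer \<beta> (k + l) *
      (A k * pochhammer (\<beta> - d) k / fact k) * (pochhammer d l / fact l) * x ^ (k + l)"
    and "R \<equiv> \<lambda>n. pochhammer \<alpha> n / fact n * (pochhammer (\<beta> - d) n / pochhammer \<beta> n * B n)"
  assumes A: "\<And>k. A k = (\<Sum>n\<le>k. of_nat (k choose n) * (-1) ^ n * B n)"
    and subexp: "subexponential A" "subexponential B"
    and \<beta>: "\<beta> \<notin> \<int>\<^sub>\<le>\<^sub>0" and x: "norm x < 1" "Re x < 1 / 2"
  shows "L x summable_on UNIV" (is ?thesis1)
    and "summable (\<lambda>n. R n * (x / (x - 1)) ^ n)" (is ?thesis2)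
    and "infsum (L x) UNIV = (1 - x) powr (-\<alpha>) * (\<Sum>n. R n * (x / (x - 1)) ^ n)" (is ?thesis3)
proof -
  have L_summable: "L x summable_on UNIV" if "norm x < 1" for x
    unfolding L_def using that \<beta> subexp
      subexponential_mult[OF subexp(1) subexponential_pochhammer_fact[of "\<beta> - d"]]
    by (intro subexponential_double_summable subexponential_pochhammer_ratio
        subexponential_pochhammer_fact) auto
  show ?thesis1 by (rule L_summable[OF x(1)])

  have R_subexp: "subexponential R"
    unfolding R_def using \<beta> subexp
    by (intro subexponential_mult subexponential_pochhammer_ratio subexponential_pochhammer_fact)
  have R_summable: "summable (\<lambda>n. R n * z ^ n)" if "norm z < 1" for z
    using R_subexp that by (rule subexponential_summable)
  \<comment> \<open>The half-plane Re z < 1/2 consists of the points nearer to 0 than to 1.\<close>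
  have Mobius_less_1: "norm (z / (z - 1)) < 1" if "Re z < 1 / 2" for z
  proof -
    have "(norm z)\<^sup>2 < (norm (z - 1))\<^sup>2"
      using that unfolding cmod_power2 by (simp add: power2_eq_square algebra_simps)
    hence "norm z < norm (z - 1)" by (rule power2_less_imp_less) simp
    moreover from this have "norm (z - 1) > 0" by (rule le_less_trans[OF norm_ge_zero])
    ultimately show ?thesis by (simp add: norm_divide)
  qed
  show ?thesis2 by (intro R_summable Mobius_less_1 x)

  define b where "b n = (-1) ^ n * (pochhammer (\<beta> - d) n / pochhammer \<beta> n * B n)" for n
  define C where "C N = pochhammer \<alpha> N / fact N * (\<Sum>n\<le>N. of_nat (N choose n) * b n)" for N
  \<comment> \<open>Vandermonde is used with e = \<beta>-d, so that e+d = \<beta>. The resulting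
    (\<beta>+n)_(N-n) cancels against (\<beta>)_N and leaves the 1/(\<beta>)_n contained in
    \<open>b\<close>.\<close>
  have L_coeff: "(\<Sum>k\<le>N. L y (k, N - k)) = C N * y ^ N" for N y
  proof -
    have "(\<Sum>k\<le>N. L y (k, N - k)) = (\<Sum>k\<le>N. pochhammer \<alpha> N / pochhammer \<beta> N / fact N * y ^ N *
        (of_nat (N choose k) * A k * pochhammer (\<beta> - d) k * pochhammer d (N - k)))"
      by (intro sum.cong) (auto simp: L_def binomial_fact mult_ac)
    also have "\<dots> = pochhammer \<alpha> N / pochhammer \<beta> N / fact N * y ^ N *
        (\<Sum>n\<le>N. of_nat (N choose n) * ((-1) ^ n * B n) * pochhammer (\<beta> - d) n *
           pochhammer (\<beta> - d + d + of_nat n) (N - n))"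
      unfolding sum_distrib_left[symmetric]
      by (subst binomial_transform_Vandermonde[where B = "\<lambda>n. (-1) ^ n * B n"])
        (simp_all add: A mult.assoc)
    also have "\<dots> = C N * y ^ N"
      unfolding C_def sum_distrib_left sum_distrib_right
    proof (rule sum.cong)
      fix n assume "n \<in> {..N}"
      hence "pochhammer \<beta> N = pochhammer \<beta> n * pochhammer (\<beta> + of_nat n) (N - n)"
        by (intro pochhammer_product) auto
      moreover have "pochhammer (\<beta> + of_nat n) (N - n) \<noteq> 0" "pochhammer \<beta> n \<noteq> 0"
        using \<beta> by (auto simp: pochhammer_nonzero pochhammer_shift_nonzero)
      ultimately show "pochhammer \<alpha> N / pochhammer \<beta> N / fact N * y ^ N *
          (of_nat (N choose n) * ((-1) ^ n * B n) * pochhammer (\<beta> - d) n *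
           pochhammer (\<beta> - d + d + of_nat n) (N - n)) =
          pochhammer \<alpha> N / fact N * (of_nat (N choose n) * b n) * y ^ N"
        by (simp add: b_def mult_ac)
    qed simp
    finally show ?thesis .
  qed
  have L_sums: "(\<lambda>N. C N * y ^ N) sums infsum (L y) UNIV" if "norm y < 1" for y
    using has_sum_diagonal_sums[OF has_sum_infsum[OF L_summable[OF that]]] by (simp add: L_coeff)

  have near_0: "infsum (L y) UNIV = (1 - y) powr (-\<alpha>) * (\<Sum>n. R n * (y / (y - 1)) ^ n)"
    if y: "norm y < 1 / 2" for y
  proof -
    have y1: "norm y < 1" "y \<noteq> 1" using y by auto
    \<comment> \<open>\<open>G\<close> is the right-hand side with (1-y)^(-\<alpha>-n) expanded in
      powers y^j. Its antidiagonals sum to \<open>C N * y ^ N\<close>, its rows to the terms of the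
      series in y/(y-1).\<close>
    define G where "G = (\<lambda>(n, j). pochhammer \<alpha> (n + j) / fact (n + j) *
        (of_nat ((n + j) choose n) * b n) * y ^ (n + j))"
    have "subexponential b"
    proof -
      have "subexponential (\<lambda>n. pochhammer (\<beta> - d) n / pochhammer \<beta> n * B n)"
        using \<beta> subexp by (intro subexponential_mult subexponential_pochhammer_ratio)
      thus ?thesis by (simp add: subexponential_def b_def norm_mult norm_divide norm_power)
    qed
    \<comment> \<open>The argument 2y absorbs the bound 2^(n+j) for the binomial coefficient; this
      is where |y| < 1/2 is used.\<close>
    hence "(\<lambda>(n, j). pochhammer \<alpha> (n + j) / fact (n + j) * b n * 1 * (2 * y) ^ (n + j)) summable_on UNIV"
      using y by (intro subexponential_double_summable subexponential_pochhammer_fact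
          subexponential_const) (auto simp: norm_mult)
    hence "(\<lambda>p. norm (case p of (n, j) \<Rightarrow>
        pochhammer \<alpha> (n + j) / fact (n + j) * b n * 1 * (2 * y) ^ (n + j))) summable_on UNIV"
      by (simp add: summable_on_iff_abs_summable_on_complex)
    hence "(\<lambda>p. norm (G p)) summable_on UNIV"
    proof (rule Infinite_Sum.abs_summable_on_comparison_test)
      fix p :: "nat \<times> nat"
      obtain n j where p: "p = (n, j)" by force
      have "real ((n + j) choose n) \<le> 2 ^ (n + j)"
        using binomial_le_pow2[of "n + j" n] by (metis of_nat_le_iff of_nat_numeral of_nat_power)
      hence "norm (pochhammer \<alpha> (n + j) / fact (n + j) * b n * y ^ (n + j)) * real ((n + j) choose n) \<le>
          norm (pochhammer \<alpha> (n + j) / fact (n + j) * b n * y ^ (n + j)) * 2 ^ (n + j)"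
        by (intro mult_left_mono) auto
      thus "norm (G p) \<le> norm (case p of (n, j) \<Rightarrow>
          pochhammer \<alpha> (n + j) / fact (n + j) * b n * 1 * (2 * y) ^ (n + j))"
        by (simp add: p G_def norm_mult norm_divide norm_power power_mult_distrib mult_ac)
    qed
    hence G_summable: "G summable_on UNIV"
      by (rule abs_summable_summable)
    have "(\<lambda>N. \<Sum>n\<le>N. G (n, N - n)) sums infsum G UNIV"
      by (intro has_sum_diagonal_sums has_sum_infsum G_summable)
    moreover have "(\<Sum>n\<le>N. G (n, N - n)) = C N * y ^ N" for N
      by (simp add: G_def C_def sum_distrib_left sum_distrib_right mult_ac)
    ultimately have L_eq: "infsum (L y) UNIV = infsum G UNIV"
      using L_sums[OF y1(1)] by (simp add: sums_iff)

    have row: "((\<lambda>j. G (n, j)) has_sum (R n * (y / (y - 1)) ^ n * (1 - y) powr (-\<alpha>))) UNIV" for n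
    proof -
      \<comment> \<open>Summability of \<open>G\<close> provides an unordered row sum; its value is
        then read off from the ordinary binomial series by uniqueness of limits.\<close>
      have "(\<lambda>j. G (n, j)) summable_on UNIV"
        using G_summable summable_on_SigmaD1[of "\<lambda>n j. G (n, j)" UNIV "\<lambda>_. UNIV" n] by simp
      hence hs: "((\<lambda>j. G (n, j)) has_sum (infsum (\<lambda>j. G (n, j)) UNIV)) UNIV"
        by (rule has_sum_infsum)
      have "(\<lambda>j. ((-\<alpha> - of_nat n) gchoose j) * (-y) ^ j) sums (1 + (-y)) powr (-\<alpha> - of_nat n)"
        using y1 by (intro gen_binomial_complex) auto
      hence "(\<lambda>j. R n * (-y) ^ n * (((-\<alpha> - of_nat n) gchoose j) * (-y) ^ j)) sums
          (R n * (-y) ^ n * (1 + (-y)) powr (-\<alpha> - of_nat n))"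
        by (rule sums_mult)
      moreover have "R n * (-y) ^ n * (((-\<alpha> - of_nat n) gchoose j) * (-y) ^ j) = G (n, j)" for j
      proof -
        have "((-\<alpha> - of_nat n) gchoose j) * (-y) ^ j = pochhammer (\<alpha> + of_nat n) j / fact j * y ^ j"
        proof -
          have "((-\<alpha> - of_nat n) gchoose j) * (-y) ^ j =
              ((-1) ^ j * (-1) ^ j) * (pochhammer (\<alpha> + of_nat n) j / fact j * y ^ j)"
            by (simp only: gbinomial_pochhammer power_minus[of y]) (simp add: add.commute)
          also have "(-1) ^ j * (-1) ^ j = (1 :: complex)"
            by (simp flip: power_mult_distrib)
          finally show ?thesis by simp
        qed
        moreover have "R n * (-y) ^ n = pochhammer \<alpha> n / fact n * b n * y ^ n"
          by (simp add: R_def b_def power_minus[of y])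
        moreover have "of_nat ((n + j) choose n) / fact (n + j) = (1 / (fact n * fact j) :: complex)"
          by (simp add: binomial_fact)
        moreover have "G (n, j) = pochhammer \<alpha> n * pochhammer (\<alpha> + of_nat n) j * b n * y ^ n * y ^ j *
            (of_nat ((n + j) choose n) / fact (n + j))"
          by (simp add: G_def pochhammer_product' power_add mult_ac)
        ultimately show ?thesis
          by (simp only:) (simp add: mult_ac)
      qed
      \<comment> \<open>The surplus factor (1-y)^(-n) of the binomial series combines with (-y)^n to
        the power of y/(y-1).\<close>
      moreover have "(-y) ^ n * (1 + (-y)) powr (-\<alpha> - of_nat n) =
          (y / (y - 1)) ^ n * (1 - y) powr (-\<alpha>)"
      proof -
        have "(1 - y) powr (-\<alpha> - of_nat n) = (1 - y) powr (-\<alpha>) / (1 - y) ^ n"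
          using y1 by (simp add: powr_diff powr_nat')
        moreover have "y / (y - 1) = (-y) / (1 - y)"
          using minus_divide_divide[of y "y - 1"] by simp
        ultimately show ?thesis by (simp only: power_divide) simp
      qed
      ultimately have "(\<lambda>j. G (n, j)) sums (R n * (y / (y - 1)) ^ n * (1 - y) powr (-\<alpha>))"
        by (simp add: mult.assoc)
      hence "infsum (\<lambda>j. G (n, j)) UNIV = R n * (y / (y - 1)) ^ n * (1 - y) powr (-\<alpha>)"
        by (rule sums_unique2[OF has_sum_imp_sums[OF hs]])
      with hs show ?thesis by (simp only:)
    qed
    have "((\<lambda>n. R n * (y / (y - 1)) ^ n * (1 - y) powr (-\<alpha>)) has_sum (infsum G UNIV)) UNIV"
    proof (rule has_sum_SigmaD[where f = G and B = "\<lambda>_. UNIV"])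
      show "(G has_sum infsum G UNIV) (UNIV \<times> UNIV)"
        using has_sum_infsum[OF G_summable] by simp
    qed (rule row)
    hence "(\<lambda>n. R n * (y / (y - 1)) ^ n * (1 - y) powr (-\<alpha>)) sums infsum G UNIV"
      by (rule has_sum_imp_sums)
    moreover have "summable (\<lambda>n. R n * (y / (y - 1)) ^ n)"
      using y abs_Re_le_cmod[of y] by (intro R_summable Mobius_less_1) auto
    hence "(\<lambda>n. R n * (y / (y - 1)) ^ n * (1 - y) powr (-\<alpha>)) sums
        ((\<Sum>n. R n * (y / (y - 1)) ^ n) * (1 - y) powr (-\<alpha>))"
      by (intro sums_mult2 summable_sums)
    ultimately have "infsum G UNIV = (\<Sum>n. R n * (y / (y - 1)) ^ n) * (1 - y) powr (-\<alpha>)"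
      by (rule sums_unique2)
    thus ?thesis by (simp only: L_eq mult.commute)
  qed

  define D where "D = ball 0 1 \<inter> {z :: complex. Re z < 1 / 2}"
  define H where "H y = infsum (L y) UNIV - (1 - y) powr (-\<alpha>) * (\<Sum>n. R n * (y / (y - 1)) ^ n)" for y
  have "(\<lambda>z. infsum (L z) UNIV) holomorphic_on ball 0 1"
    using L_sums by (intro power_series_holomorphic[where a = C]) simp
  hence hol_L: "(\<lambda>z. infsum (L z) UNIV) holomorphic_on D"
    by (rule holomorphic_on_subset) (simp add: D_def)
  have D_ne_1: "y \<noteq> 1" if "y \<in> D" for y
    using that by (auto simp: D_def)
  have "(\<lambda>y. y / (y - 1)) holomorphic_on D"
    by (intro holomorphic_intros) (use D_ne_1 in auto)
  moreover have "(\<lambda>z. \<Sum>n. R n * z ^ n) holomorphic_on ball 0 1"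
    using R_summable by (intro power_series_holomorphic[where a = R]) (simp add: summable_sums)
  moreover have "(\<lambda>y. y / (y - 1)) ` D \<subseteq> ball 0 1"
  proof
    fix w assume "w \<in> (\<lambda>y. y / (y - 1)) ` D"
    then obtain y where "w = y / (y - 1)" "Re y < 1 / 2" by (auto simp: D_def)
    thus "w \<in> ball 0 1" using Mobius_less_1[of y] by simp
  qed
  ultimately have "((\<lambda>z. \<Sum>n. R n * z ^ n) \<circ> (\<lambda>y. y / (y - 1))) holomorphic_on D"
    by (rule holomorphic_on_compose_gen)
  hence hol_R: "(\<lambda>y. \<Sum>n. R n * (y / (y - 1)) ^ n) holomorphic_on D"
    by (simp only: o_def)
  \<comment> \<open>On \<open>D\<close> the real part of 1-y exceeds 1/2, so the branch cut is
    avoided.\<close>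
  have hol_powr: "(\<lambda>y. (1 - y) powr (-\<alpha>)) holomorphic_on D"
    by (intro holomorphic_intros) (auto simp: D_def complex_nonpos_Reals_iff)
  have hol_H: "H holomorphic_on D"
    unfolding H_def by (intro holomorphic_on_diff holomorphic_on_mult hol_L hol_R hol_powr)
  have "H x = 0"
  proof (rule analytic_continuation[OF hol_H, of "ball 0 (1 / 2)" 0])
    show "open D"
      unfolding D_def by (intro open_Int open_halfspace_Re_lt open_ball)
    show "connected D"
      unfolding D_def by (intro convex_connected convex_Int convex_halfspace_Re_lt convex_ball)
    show "ball 0 (1 / 2) \<subseteq> D"
    proof
      fix y :: complex assume "y \<in> ball 0 (1 / 2)"
      thus "y \<in> D" using abs_Re_le_cmod[of y] by (simp add: D_def)
    qed
    show "(0::complex) islimpt ball 0 (1 / 2)" by (simp add: islimpt_ball)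
    show "0 \<in> D" "x \<in> D" using x by (simp_all add: D_def)
    show "H z = 0" if "z \<in> ball 0 (1 / 2)" for z
      using near_0[of z] that by (simp add: H_def)
  qed
  thus ?thesis3 by (simp add: H_def)
qed

section \<open>Zeros of the polynomial, and the final identity\<close>

text \<open>In p(-t) / p(0), both factored over the zeros, the leading coefficient cancels and each
  zero contributes (-t-\<xi>)/(-\<xi>) = (\<xi>+t)/\<xi>.\<close>

lemma prod_roots_shift:
  fixes p :: "complex poly"
  assumes "poly p 0 = 1" "mset \<xi>s = proots p"
  shows "(\<Prod>\<xi>\<leftarrow>\<xi>s. (\<xi> + t) / \<xi>) = poly p (-t)"
proof -
  have poly_eq: "poly p y = lead_coeff p * (\<Prod>\<xi>\<leftarrow>\<xi>s. y - \<xi>)" for y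
  proof -
    have "p = smult (lead_coeff p) (\<Prod>\<xi>\<leftarrow>\<xi>s. [:-\<xi>, 1:])"
      using complex_poly_decompose_multiset[of p]
      by (simp add: assms(2)[symmetric] prod_mset_prod_list flip: mset_map)
    hence "poly p y = lead_coeff p * poly (\<Prod>\<xi>\<leftarrow>\<xi>s. [:-\<xi>, 1:]) y"
      by (metis poly_smult)
    also have "poly (\<Prod>\<xi>\<leftarrow>\<xi>s. [:-\<xi>, 1:]) y = (\<Prod>\<xi>\<leftarrow>\<xi>s. y - \<xi>)"
      by (induction \<xi>s) (auto simp: algebra_simps)
    finally show ?thesis .
  qed
  have ratio: "(\<Prod>\<xi>\<leftarrow>\<xi>s. (\<xi> + t) / \<xi>) = (\<Prod>\<xi>\<leftarrow>\<xi>s. -t - \<xi>) / (\<Prod>\<xi>\<leftarrow>\<xi>s. 0 - \<xi>)"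
  proof (induction \<xi>s)
    case (Cons \<xi> \<xi>s)
    have "(\<xi> + t) / \<xi> = (-t - \<xi>) / (0 - \<xi>)"
      \<comment> \<open>At \<xi> = 0 both quotients take the default value 0 of division by
        zero.\<close>
      by (cases "\<xi> = 0") (simp_all add: field_simps)
    with Cons show ?case by (simp only: list.map prod_list.Cons times_divide_times_eq)
  qed simp
  have "lead_coeff p * (\<Prod>\<xi>\<leftarrow>\<xi>s. 0 - \<xi>) = 1"
    using poly_eq[of 0] assms(1) by simp
  hence "lead_coeff p = 1 / (\<Prod>\<xi>\<leftarrow>\<xi>s. 0 - \<xi>)"
    by (metis mult_not_zero nonzero_eq_divide_eq zero_neq_one)
  thus ?thesis
    using poly_eq[of "-t"] ratio by simp
qed

theorem mainTheorem4:
  fixes r m :: nat and ms :: "nat list" and fs \<xi>s :: "complex list"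
    and \<alpha> \<beta> a c d x :: complex
  assumes "length ms = r" and "length fs = r"
    and "\<forall>m'\<in>set ms. m' > 0" and "m = sum_list ms"
    and "\<beta> \<notin> \<int>\<^sub>\<le>\<^sub>0" and "c \<notin> \<int>\<^sub>\<le>\<^sub>0" and "\<forall>f\<in>set fs. f \<notin> \<int>\<^sub>\<le>\<^sub>0"
    and "pochhammer (c - a - of_nat m) m \<noteq> 0"
    and "\<forall>f\<in>set fs. a \<noteq> f"
    and "degree (Q_poly a c fs ms) = m"
    and "mset \<xi>s = proots (Q_poly a c fs ms)"
    and "norm x < 1" and "Re x < 1 / 2"
  shows "kampe_de_feriet_term
           [\<alpha>] ([a, \<beta> - d] @ map2 (\<lambda>f m'. f + of_nat m') fs ms) [d]
           [\<beta>] ([c] @ fs) [] x x summable_on UNIV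
       \<and> summable (hypergeom_shifted_term
           [\<alpha>, \<beta> - d, c - a - of_nat m] [\<beta>, c] \<xi>s (x / (x - 1)))
       \<and> kampe_de_feriet
           [\<alpha>] ([a, \<beta> - d] @ map2 (\<lambda>f m'. f + of_nat m') fs ms) [d]
           [\<beta>] ([c] @ fs) [] x x =
         (1 - x) powr (-\<alpha>) *
           hypergeom_shifted [\<alpha>, \<beta> - d, c - a - of_nat m] [\<beta>, c] \<xi>s (x / (x - 1))"
proof -
  define B where "B n = pochhammer (c - a - of_nat m) n / pochhammer c n *
    poly (Q_poly a c fs ms) (-of_nat n)" for n
  define A where "A k = pochhammer a k / pochhammer c k *
    (poch_list (map2 (\<lambda>f m. f + of_nat m) fs ms) k / poch_list fs k)" for k
  define L where "L = (\<lambda>(k, l). pochhammer \<alpha> (k + l) / pochhammer \<beta> (k + l) *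
    (A k * pochhammer (\<beta> - d) k / fact k) * (pochhammer d l / fact l) * x ^ (k + l))"
  define R where "R = (\<lambda>n. pochhammer \<alpha> n / fact n * (pochhammer (\<beta> - d) n / pochhammer \<beta> n * B n) *
    (x / (x - 1)) ^ n)"
  have len: "length fs = length ms" using assms(1,2) by simp
  have A_eq: "A k = (\<Sum>n\<le>k. of_nat (k choose n) * (-1) ^ n * B n)" for k
    unfolding A_def B_def assms(4)
    using assms by (intro Kummer_type_coefficients) auto
  \<comment> \<open>The part of \<open>A\<close> coming from the f_j is a polynomial in the index,
    divided by a constant.\<close>
  have A_sub: "subexponential A"
    unfolding A_def poch_list_shift_ratio[OF len assms(7)]
    using subexponential_mult[OF subexponential_poly_of_nat subexponential_const] assms(6)
    by (intro subexponential_mult subexponential_pochhammer_ratio) (auto simp: divide_inverse)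
  \<comment> \<open>Composition with -x presents Q_m(-n) as a polynomial evaluated at n.\<close>
  have B_sub: "subexponential B"
    unfolding B_def
    using subexponential_poly_of_nat[of "pcompose (Q_poly a c fs ms) [:0, -1:]"] assms(6)
    by (intro subexponential_mult subexponential_pochhammer_ratio) (auto simp: poly_pcompose)
  note main = binomial_transform_double_series[of A B \<beta> x \<alpha> d,
      OF A_eq A_sub B_sub assms(5,12,13), folded L_def R_def]
  have "kampe_de_feriet_term [\<alpha>] ([a, \<beta> - d] @ map2 (\<lambda>f m'. f + of_nat m') fs ms) [d]
      [\<beta>] ([c] @ fs) [] x x = L"
    by (auto simp: fun_eq_iff kampe_de_feriet_term_def poch_list_def A_def L_def power_add mult_ac)
  moreover have "hypergeom_shifted_term [\<alpha>, \<beta> - d, c - a - of_nat m] [\<beta>, c] \<xi>s (x / (x - 1)) = R"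
  proof
    fix n
    \<comment> \<open>The shifted parameters reproduce exactly the factor Q_m(-n) of
      \<open>B n\<close>, thanks to Q_m(0) = 1.\<close>
    have "(\<Prod>\<xi>\<leftarrow>\<xi>s. (\<xi> + of_nat n) / \<xi>) = poly (Q_poly a c fs ms) (-of_nat n)"
      using assms len by (intro prod_roots_shift poly_Q_poly_0) auto
    thus "hypergeom_shifted_term [\<alpha>, \<beta> - d, c - a - of_nat m] [\<beta>, c] \<xi>s (x / (x - 1)) n = R n"
      by (simp add: hypergeom_shifted_term_def hypergeom_term_def poch_list_def B_def R_def mult_ac)
  qed
  ultimately show ?thesis
    using main by (simp only: kampe_de_feriet_def hypergeom_shifted_def simp_thms)
qed

end
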